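(* Let $m$ be a positive integer and let $S$ be a linear space of $m\times m$ real symmetric matrices (a linear subspace of the real vector space of $m\times m$ real symmetric matrices). Suppose that for every $x\in S^{m-1}$ there exists $M\in S$ with $x^*Mx\neq 0$. Then there exists $M\in S$ with $\det M\neq 0$.
   Context: $S^{m-1}$ denotes the unit sphere of $\mathbb{R}^m$, whose elements are regarded as column vectors; $x^*$ is the (conjugate) transpose. *)

theory Defs
  imports "HOL-Analysis.Analysis"
begin

end

theory Submission
  imports Defs
begin

text \<open>
  The matrix of \<open>S\<close> to look at is one of maximal rank, say \<open>M\<close>. If \<open>M\<close> were singular, it would
  kill a unit vector \<open>x\<close>, and by hypothesis some \<open>N \<in> S\<close> has \<open>x \<bullet> N x \<noteq> 0\<close>. Since \<open>M\<close> is symmetric,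
  \<open>x\<close> spans a direction that is missing both from the row space and from the column space of \<open>M\<close>, and
  \<open>N\<close> has a nonzero entry exactly in this corner. In block form, with \<open>A\<close> invertible,
  the compression of \<open>M + t N\<close> to the range of \<open>M\<close> plus the line of \<open>x\<close> is \<open>(A + t B, t b; t b\<^sup>T, t d)\<close> with \<open>d \<noteq> 0\<close>; its determinant is
  \<open>t d det A + O(t\<^sup>2)\<close>, so for small \<open>t \<noteq> 0\<close> the rank of \<open>M + t N \<in> S\<close> exceeds that of \<open>M\<close>, which is
  impossible. The rank increase is the lemma \<open>rank_less_rank_perturbation\<close>, proved
  by norm estimates in place of minors and determinants.
\<close>

text \<open>
  To first order in \<open>t\<close>, the perturbation \<open>t N\<close> acts on the kernel of \<open>M\<close> modulo the range of \<open>M\<close>, and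
  the pairing of \<open>N x\<close> with a vector \<open>y\<close> annihilating the range detects that this action is nonzero.
  The proof shows that \<open>M + t N\<close> is injective on the sum of the row space of \<open>M\<close> and the line of \<open>x\<close>:
  pairing \<open>(M + t N) (w + a x) = 0\<close> with \<open>y\<close> expresses \<open>a\<close> linearly in \<open>w\<close> by a formula
  without \<open>t\<close>, so that \<open>M w\<close> is \<open>t\<close> times a fixed linear function of \<open>w\<close>.
  On the row space \<open>M\<close> is bounded below, hence \<open>w = 0\<close> once \<open>t\<close> is small.
\<close>

lemma rank_less_rank_perturbation:
  fixes M N :: "real ^ 'n ^ 'm"
  assumes x: "M *v x = 0" and y: "y v* M = 0" and c: "y \<bullet> (N *v x) \<noteq> 0"
  shows "\<exists>t. rank M < rank (M + t *\<^sub>R N)"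
proof -
  define W where "W = span (rows M)"
  \<comment> \<open>\<open>P w = N (w + a x)\<close> for the \<open>a\<close> that makes this vector orthogonal to \<open>y\<close>.\<close>
  define P where "P = (\<lambda>w. N *v w - ((y \<bullet> (N *v w)) / (y \<bullet> (N *v x))) *\<^sub>R (N *v x))"
  have W: "subspace W" "closed W"
    by (simp_all add: W_def closed_subspace)
  have M_inj: "\<forall>w\<in>W. M *v w = 0 \<longrightarrow> w = 0"
    unfolding W_def using nullspace_inter_rowspace by blast
  obtain e where e: "e > 0" "\<And>w. w \<in> W \<Longrightarrow> e * norm w \<le> norm (M *v w)"
    using injective_imp_isometric[OF W(2,1) matrix_vector_mul_bounded_linear M_inj] by blast
  have "linear P"
    by (auto intro!: linearI simp: P_def matrix_vector_right_distrib inner_add_right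
        add_divide_distrib matrix_vector_mult_scaleR algebra_simps)
  then obtain K where K: "K > 0" "\<And>w. norm (P w) \<le> K * norm w"
    using linear_bounded_pos by blast
  \<comment> \<open>Any positive \<open>t\<close> with \<open>t * K < e\<close> would do.\<close>
  define t where "t = e / (2 * K)"
  have t: "t > 0" "t * K = e / 2"
    using e K by (simp_all add: t_def)
  define T where "T = M + t *\<^sub>R N"
  have T: "T *v v = M *v v + t *\<^sub>R (N *v v)" for v
    by (simp add: T_def matrix_vector_mult_add_rdistrib scaleR_matrix_vector_assoc)
  have T_inj: "v = 0" if v: "v \<in> span (insert x W)" and Tv: "T *v v = 0" for v
  proof -
    obtain a where "v - a *\<^sub>R x \<in> W"
      using v W(1) by (auto simp: span_insert span_eq_iff[THEN iffD2])
    then obtain w where w: "w \<in> W" "v = w + a *\<^sub>R x"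
      by (metis diff_add_cancel)
    have "y \<bullet> (M *v v) = 0"
      using y by (metis dot_lmul_matrix inner_zero_left)
    then have "y \<bullet> (N *v v) = 0"
      using Tv t(1) by (metis T inner_add_right inner_scaleR_right inner_zero_right add_0
          mult_eq_0_iff less_irrefl)
    then have a: "a = - (y \<bullet> (N *v w)) / (y \<bullet> (N *v x))"
      using c by (simp add: w matrix_vector_right_distrib matrix_vector_mult_scaleR
          inner_add_right field_simps)
    have Nv: "N *v v = P w"
      by (simp add: w a P_def matrix_vector_right_distrib matrix_vector_mult_diff_distrib
          matrix_vector_mult_scaleR)
    have "M *v v = M *v w"
      by (simp add: w matrix_vector_right_distrib matrix_vector_mult_scaleR x)
    then have "M *v w = - (t *\<^sub>R P w)"
      using Tv Nv by (simp add: T eq_neg_iff_add_eq_0)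
    then have "norm (M *v w) = t * norm (P w)"
      using t(1) by simp
    also have "\<dots> \<le> t * (K * norm w)"
      using K(2) t(1) by (simp add: mult_left_mono)
    also have "\<dots> = e / 2 * norm w"
      using t(2) by (metis mult.assoc)
    finally have "e * norm w \<le> e / 2 * norm w"
      using e(2)[OF w(1)] by linarith
    then have "w = 0"
      using e(1) by simp
    then show "v = 0"
      using a w(2) by simp
  qed
  have "x \<notin> W"
    using M_inj x c by auto
  then have "rank M + 1 = dim (insert x W)"
    using span_eq_iff[THEN iffD2, OF W(1)]
    by (simp only: dim_insert row_rank_def W_def dim_span if_False)
  also have "\<dots> = dim ((*v) T ` insert x W)"
  proof (rule dim_image_eq[symmetric])
    show "inj_on ((*v) T) (span (insert x W))"
    proof (rule inj_onI)
      fix u v assume uv: "u \<in> span (insert x W)" "v \<in> span (insert x W)" "T *v u = T *v v"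
      have "u - v = 0"
        using uv by (intro T_inj) (simp_all add: span_diff matrix_vector_mult_diff_distrib)
      then show "u = v" by simp
    qed
  qed simp
  also have "\<dots> \<le> rank T"
    unfolding rank_dim_range by (intro dim_subset image_mono) simp
  finally show ?thesis
    unfolding T_def by (intro exI[of _ t]) simp
qed

theorem theorem1p3:
  fixes S :: "(real ^ 'm ^ 'm) set"
  assumes "subspace S"
    and "\<And>M. M \<in> S \<Longrightarrow> transpose M = M"
    and "\<And>x :: real ^ 'm. x \<in> sphere 0 1 \<Longrightarrow> \<exists>M\<in>S. x \<bullet> (M *v x) \<noteq> 0"
  shows "\<exists>M\<in>S. det M \<noteq> 0"
proof -
  have "0 \<in> S" "\<forall>M. M \<in> S \<longrightarrow> rank M < CARD('m) + 1"
    using assms(1) rank_bound[where 'm='m and 'n='m] by (auto simp: subspace_0 less_Suc_eq_le)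
  then obtain M where M: "M \<in> S" "\<And>L. L \<in> S \<Longrightarrow> rank L \<le> rank M"
    using ex_has_greatest_nat[of "\<lambda>M. M \<in> S" 0 rank] by blast
  have "det M \<noteq> 0"
  proof
    assume "det M = 0"
    then obtain z where z: "M *v z = 0" "z \<noteq> 0"
      by (metis invertible_det_nz invertible_left_inverse matrix_left_invertible_ker)
    define x where "x = z /\<^sub>R norm z"
    have x: "M *v x = 0" "x \<in> sphere 0 1"
      using z by (simp_all add: x_def matrix_vector_mult_scaleR)
    then obtain N where N: "N \<in> S" "x \<bullet> (N *v x) \<noteq> 0"
      using assms(3) by blast
    have "x v* M = 0"
      using x(1) assms(2)[OF M(1)] by (metis transpose_matrix_vector)
    then obtain t where "rank M < rank (M + t *\<^sub>R N)"
      using rank_less_rank_perturbation x(1) N(2) by blast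
    moreover have "M + t *\<^sub>R N \<in> S"
      using assms(1) M(1) N(1) by (simp add: subspace_add subspace_scale)
    ultimately show False
      using M(2) by fastforce
  qed
  then show ?thesis
    using M(1) by blast
qed

end
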